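(* The feasible set of the optimal perfect privacy estimator design problem with continuous measurements, namely, over tuples $P=(P_i)_{i=1}^m$ of bounded measurable functions $P_i:\mathbb{R}\to\mathbb{R}$, $$\text{minimize } \mathsf{E}\big[L(Y,\hat Y_P(Z))\big]\quad\text{subject to}\quad P_i(z)\ge0\ \ \forall i,z,\qquad \sum_{i=1}^mP_i(z)=1\ \ \forall z,\qquad \int_{\mathbb{R}} P_i(z)\big(p_Z(z)-p_Z(z\mid X=x_j)\big)\,dz=0\ \ \forall i,j,$$ is always non-empty.
   Context: $X$ (private) and $Y$ (public) are possibly correlated discrete random variables with finite support sets $\mathcal{X}=\{x_1,\dots,x_n\}$ and $\mathcal{Y}=\{y_1,\dots,y_m\}$. The measurement $Z$ is a real random variable, jointly distributed with $(X,Y)$, absolutely continuous with respect to Lebesgue measure with density $p_Z$; $p_Z(\cdot\mid X=x_j)$ is the conditional density of $Z$ given $X=x_j$. Randomized estimator: $\hat Y_P(Z)$ is the $\mathcal{Y}$-valued random variable that, given $Z=z$, equals $y_i$ with probability $P_i(z)$, the randomization being conditionally independent of $(X,Y)$ given $Z$. Loss: $L(Y,\hat Y)=1$ if $Y\neq\hat Y$, and $0$ otherwise. *)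

theory Defs
  imports "HOL-Probability.Probability"
begin

record 'a min_problem =
  variables :: "'a set"
  objective :: "'a \<Rightarrow> real"
  satisfies_constraints :: "'a \<Rightarrow> bool"

definition feasible_set :: "'a min_problem \<Rightarrow> 'a set" where
  "feasible_set p = {x \<in> variables p. satisfies_constraints p x}"

text \<open>A discrete random variable with support set \<open>S\<close>; the variable may leave \<open>S\<close> on a null
  event, but every point of \<open>S\<close> is an atom.\<close>
definition discrete_rv_with_support :: "'w measure \<Rightarrow> ('w \<Rightarrow> 'a) \<Rightarrow> 'a set \<Rightarrow> bool" where
  "discrete_rv_with_support M X S \<longleftrightarrow>
     X \<in> measurable M (count_space UNIV) \<and>
     (AE \<omega> in M. X \<omega> \<in> S) \<and>
     S = {a. measure M {\<omega> \<in> space M. X \<omega> = a} > 0}"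

text \<open>Nonnegativity is explicit because \<^const>\<open>ennreal\<close> truncates negative values to \<open>0\<close>.\<close>
definition has_real_density :: "'w measure \<Rightarrow> ('w \<Rightarrow> real) \<Rightarrow> (real \<Rightarrow> real) \<Rightarrow> bool" where
  "has_real_density M Z p \<longleftrightarrow>
     p \<in> borel_measurable borel \<and> (\<forall>z. 0 \<le> p z) \<and> distributed M lborel Z (\<lambda>z. ennreal (p z))"

text \<open>A density of \<open>Z\<close> under the conditional probability given the non-null event \<open>X = a\<close>.\<close>
definition has_cond_density ::
    "'w measure \<Rightarrow> ('w \<Rightarrow> 'x) \<Rightarrow> 'x \<Rightarrow> ('w \<Rightarrow> real) \<Rightarrow> (real \<Rightarrow> real) \<Rightarrow> bool" where
  "has_cond_density M X a Z p \<longleftrightarrow>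
     has_real_density (uniform_measure M {\<omega> \<in> space M. X \<omega> = a}) Z p"

definition loss :: "'y \<Rightarrow> 'y \<Rightarrow> real" where
  "loss y y' = (if y \<noteq> y' then 1 else 0)"

text \<open>The conditional law of the randomized estimator given \<open>Z = z\<close>, where \<open>y 1, \<dots>, y m\<close>
  enumerates the support of \<open>Y\<close>. It is meaningful when \<open>P 1 z, \<dots>, P m z\<close> is a probability vector;
  otherwise \<^const>\<open>embed_pmf\<close> is unspecified.\<close>
definition estimator_pmf ::
    "nat \<Rightarrow> (nat \<Rightarrow> 'y) \<Rightarrow> (nat \<Rightarrow> real \<Rightarrow> real) \<Rightarrow> real \<Rightarrow> 'y pmf" where
  "estimator_pmf m y P z = map_pmf y (embed_pmf (\<lambda>i. if i \<in> {1..m} then P i z else 0))"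

text \<open>The joint law of \<open>Y\<close> and the randomized estimator: after \<open>\<omega>\<close> is drawn, the estimate is drawn
  from a law depending on \<open>\<omega>\<close> only through \<open>Z \<omega>\<close>, which is the conditional independence of the
  randomization.\<close>
definition estimation_law ::
    "'w measure \<Rightarrow> ('w \<Rightarrow> 'y) \<Rightarrow> ('w \<Rightarrow> real) \<Rightarrow> nat \<Rightarrow> (nat \<Rightarrow> 'y) \<Rightarrow> (nat \<Rightarrow> real \<Rightarrow> real)
       \<Rightarrow> ('y \<times> 'y) measure" where
  "estimation_law M Y Z m y P =
     M \<bind> (\<lambda>\<omega>. distr (measure_pmf (estimator_pmf m y P (Z \<omega>))) (count_space UNIV) (Pair (Y \<omega>)))"

definition expected_loss ::
    "'w measure \<Rightarrow> ('w \<Rightarrow> 'y) \<Rightarrow> ('w \<Rightarrow> real) \<Rightarrow> nat \<Rightarrow> (nat \<Rightarrow> 'y) \<Rightarrow> (nat \<Rightarrow> real \<Rightarrow> real) \<Rightarrow> real" where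
  "expected_loss M Y Z m y P =
     integral\<^sup>L (estimation_law M Y Z m y P) (\<lambda>(a, b). loss a b)"

text \<open>Tuples indexed by \<open>1, \<dots>, m\<close> are functions on \<^typ>\<open>nat\<close> that are \<^const>\<open>undefined\<close> off
  \<open>{1..m}\<close>. The arguments \<open>pZ\<close> and \<open>pZX a\<close> are the density of \<open>Z\<close> and its conditional density
  given \<open>X = a\<close>.\<close>
definition perfect_privacy_problem ::
    "'w measure \<Rightarrow> ('w \<Rightarrow> 'y) \<Rightarrow> ('w \<Rightarrow> real) \<Rightarrow> nat \<Rightarrow> (nat \<Rightarrow> 'x) \<Rightarrow> nat \<Rightarrow> (nat \<Rightarrow> 'y)
       \<Rightarrow> (real \<Rightarrow> real) \<Rightarrow> ('x \<Rightarrow> real \<Rightarrow> real) \<Rightarrow> (nat \<Rightarrow> real \<Rightarrow> real) min_problem" where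
  "perfect_privacy_problem M Y Z n x m y pZ pZX =
     \<lparr> variables = {1..m} \<rightarrow>\<^sub>E {f. f \<in> borel_measurable borel \<and> bounded (range f)},
       objective = expected_loss M Y Z m y,
       satisfies_constraints = (\<lambda>P.
         (\<forall>i\<in>{1..m}. \<forall>z. P i z \<ge> 0) \<and>
         (\<forall>z. (\<Sum>i=1..m. P i z) = 1) \<and>
         (\<forall>i\<in>{1..m}. \<forall>j\<in>{1..n}. (LINT z|lborel. P i z * (pZ z - pZX (x j) z)) = 0)) \<rparr>"

end

theory Submission
  imports Defs
begin

text \<open>An estimator that ignores the measurement is feasible: for constant \<open>P i\<close> the privacy
  constraint only says that the two densities have equal total mass, which is \<open>1\<close> for both.\<close>

lemma has_real_density_integral:
  assumes "prob_space N" and "has_real_density N Z p"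
  shows has_real_density_integrable: "integrable lborel p"
    and has_real_density_integral_eq_1: "integral\<^sup>L lborel p = 1"
proof -
  interpret N: prob_space N by fact
  have p: "\<And>z. 0 \<le> p z" and D: "distributed N lborel Z (\<lambda>z. ennreal (p z))"
    using assms(2) by (auto simp: has_real_density_def)
  \<comment> \<open>Testing against the constant \<open>1\<close> on the side of \<open>N\<close>
    turns both transfer rules into statements about the total mass of \<open>p\<close>.\<close>
  show "integrable lborel p"
    using distributed_integrable[OF D, of "\<lambda>_. 1"] p by simp
  show "integral\<^sup>L lborel p = 1"
    using distributed_integral[OF D, of "\<lambda>_. 1"] p by (simp add: N.prob_space)
qed

text \<open>With \<open>S\<close> empty, \<open>False\<close> would hold almost surely, impossible
  under total mass \<open>1\<close>.\<close>

lemma (in prob_space) discrete_rv_support_nonempty: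
  assumes "discrete_rv_with_support M X S"
  shows "S \<noteq> {}"
  using assms by (auto simp: discrete_rv_with_support_def)

text \<open>Support points are atoms, so conditioning divides by a nonzero mass.\<close>

lemma (in prob_space) prob_space_conditional_on_atom:
  assumes "discrete_rv_with_support M X S" and "a \<in> S"
  shows "prob_space (uniform_measure M {\<omega> \<in> space M. X \<omega> = a})"
  using assms
  by (intro prob_space_uniform_measure)
    (auto simp: discrete_rv_with_support_def emeasure_eq_measure)

theorem lemma6:
  fixes M :: "'w measure" and X :: "'w \<Rightarrow> 'x" and Y :: "'w \<Rightarrow> 'y" and Z :: "'w \<Rightarrow> real"
    and n m :: nat and x :: "nat \<Rightarrow> 'x" and y :: "nat \<Rightarrow> 'y"
    and pZ :: "real \<Rightarrow> real" and pZX :: "'x \<Rightarrow> real \<Rightarrow> real"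
  assumes "prob_space M"
    and "inj_on x {1..n}" and "discrete_rv_with_support M X (x ` {1..n})"
    and "inj_on y {1..m}" and "discrete_rv_with_support M Y (y ` {1..m})"
    and "has_real_density M Z pZ"
    and "\<And>j. j \<in> {1..n} \<Longrightarrow> has_cond_density M X (x j) Z (pZX (x j))"
  shows "feasible_set (perfect_privacy_problem M Y Z n x m y pZ pZX) \<noteq> {}"
proof -
  interpret prob_space M by fact
  \<comment> \<open>Needed for the weights \<open>1 / m\<close> to sum to \<open>1\<close>.\<close>
  have m: "m \<noteq> 0"
    using discrete_rv_support_nonempty[OF assms(5)] by auto
  \<comment> \<open>Uniform guessing. The restricted lambda makes \<open>P\<close>
    \<open>undefined\<close> off \<open>{1..m}\<close>, as \<open>\<rightarrow>\<^sub>E\<close>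
    demands.\<close>
  define P :: "nat \<Rightarrow> real \<Rightarrow> real" where "P = (\<lambda>i\<in>{1..m}. \<lambda>_. 1 / m)"
  \<comment> \<open>This is what remains of the privacy constraint once the factor
    \<open>1 / m\<close> leaves the integral.\<close>
  have "(LINT z|lborel. pZ z - pZX (x j) z) = 0" if j: "j \<in> {1..n}" for j
  proof -
    have C: "prob_space (uniform_measure M {\<omega> \<in> space M. X \<omega> = x j})"
      using j by (intro prob_space_conditional_on_atom[OF assms(3)]) auto
    have D: "has_real_density (uniform_measure M {\<omega> \<in> space M. X \<omega> = x j}) Z (pZX (x j))"
      using assms(7)[OF j] by (simp add: has_cond_density_def)
    show ?thesis
      using has_real_density_integral[OF C D] has_real_density_integral[OF assms(1,6)] by simp
  qed
  then have "P \<in> feasible_set (perfect_privacy_problem M Y Z n x m y pZ pZX)"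
    using m by (auto simp: P_def feasible_set_def perfect_privacy_problem_def)
  then show ?thesis
    by blast
qed

end
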